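(* Let $N\ge 1$, $\sigma>0$, $R>0$ and $p>1+\sigma/N$. Suppose that a nonnegative solution $u$ of problem (P) blows up at $t=T\in(0,\infty)$. If there exists $r\in(0,R)$ such that $$\limsup_{t\nearrow T}\,(T-t)^{\frac{1}{p-1}}\,\big\||\cdot|^{\frac{\sigma}{p-1}}u(\cdot,t)\big\|_{L^\infty(B_r)}=0,$$ then $0$ is not a blow-up point of $u$.
   Context: $B_\rho=\{x\in\mathbb{R}^N:|x|<\rho\}$. Problem (P) is the Hénon parabolic Cauchy--Dirichlet problem $$\partial_t u=\Delta u+|x|^\sigma u^p \ (x\in B_R,\ t\in(0,T)),\qquad u=0 \ (x\in\partial B_R,\ t\in(0,T)),\qquad u(x,0)=u_0(x)\ (x\in B_R),$$ with $u_0\in C(\overline{B_R})$ nonnegative, radially symmetric, and $u_0=0$ on $\partial B_R$. Solutions are classical and considered up to the maximal existence time $T$. The solution blows up at $t=T\in(0,\infty)$ if $T$ is the maximal existence time and $\lim_{t\nearrow T}\|u(\cdot,t)\|_{L^\infty(B_R)}=\infty$. A point $x\in\overline{B_R}$ is a blow-up point of $u$ if there exist $(x_j,t_j)\in B_R\times(0,T)$ with $x_j\to x$, $t_j\to T$ and $|u(x_j,t_j)|\to\infty$. *)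

theory Defs
  imports "HOL-Analysis.Analysis" "HOL-Probability.Essential_Supremum"
begin

definition Linf_norm :: "(real^'n) set \<Rightarrow> (real^'n \<Rightarrow> real) \<Rightarrow> ereal" where
  "Linf_norm S f = esssup (lebesgue_on S) (\<lambda>x. ereal \<bar>f x\<bar>)"

definition partial_differentiable_at :: "'n \<Rightarrow> (real^'n \<Rightarrow> real) \<Rightarrow> real^'n \<Rightarrow> bool" where
  "partial_differentiable_at i f x \<longleftrightarrow> (\<lambda>s. f (x + s *\<^sub>R axis i 1)) differentiable (at 0)"

definition partial_deriv :: "'n \<Rightarrow> (real^'n \<Rightarrow> real) \<Rightarrow> real^'n \<Rightarrow> real" where
  "partial_deriv i f x = deriv (\<lambda>s. f (x + s *\<^sub>R axis i 1)) 0"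

definition laplacian :: "(real^'n \<Rightarrow> real) \<Rightarrow> real^'n \<Rightarrow> real" where
  "laplacian f x = (\<Sum>i\<in>UNIV. partial_deriv i (partial_deriv i f) x)"

text \<open>The class $C^{2,1}$ (twice continuously differentiable in space, once in time) on
  $\Omega \times (0,T)$ for open $\Omega$.\<close>

definition C21_on :: "(real^'n) set \<Rightarrow> real \<Rightarrow> (real^'n \<Rightarrow> real \<Rightarrow> real) \<Rightarrow> bool" where
  "C21_on \<Omega> T u \<longleftrightarrow>
     (let Q = \<Omega> \<times> {0<..<T} in
       continuous_on Q (\<lambda>(x, t). u x t) \<and>
       (\<forall>(x, t) \<in> Q. (\<lambda>s. u x s) differentiable (at t)) \<and>
       continuous_on Q (\<lambda>(x, t). deriv (\<lambda>s. u x s) t) \<and>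
       (\<forall>i. (\<forall>(x, t) \<in> Q. partial_differentiable_at i (\<lambda>y. u y t) x) \<and>
            continuous_on Q (\<lambda>(x, t). partial_deriv i (\<lambda>y. u y t) x)) \<and>
       (\<forall>i j. (\<forall>(x, t) \<in> Q. partial_differentiable_at j (partial_deriv i (\<lambda>y. u y t)) x) \<and>
            continuous_on Q (\<lambda>(x, t). partial_deriv j (partial_deriv i (\<lambda>y. u y t)) x)))"

definition admissible_initial_data :: "real \<Rightarrow> (real^'n \<Rightarrow> real) \<Rightarrow> bool" where
  "admissible_initial_data R u0 \<longleftrightarrow>
     continuous_on (cball 0 R) u0 \<and>
     (\<forall>x \<in> cball 0 R. 0 \<le> u0 x) \<and>
     (\<forall>x \<in> cball 0 R. \<forall>y \<in> cball 0 R. norm x = norm y \<longrightarrow> u0 x = u0 y) \<and>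
     (\<forall>x \<in> sphere 0 R. u0 x = 0)"

text \<open>Nonnegativity is part of the notion of solution, so that the real power
  \<open>u x t powr p\<close> is only ever taken of a nonnegative base.  Only the values of \<open>u\<close> on
  \<open>cball 0 R \<times> {0..<T}\<close> are constrained.\<close>

definition nonneg_classical_solution ::
  "real \<Rightarrow> real \<Rightarrow> real \<Rightarrow> (real^'n \<Rightarrow> real) \<Rightarrow> real \<Rightarrow> (real^'n \<Rightarrow> real \<Rightarrow> real) \<Rightarrow> bool" where
  "nonneg_classical_solution R \<sigma> p u0 T u \<longleftrightarrow>
     continuous_on (cball 0 R \<times> {0..<T}) (\<lambda>(x, t). u x t) \<and>
     C21_on (ball 0 R) T u \<and>
     (\<forall>x \<in> cball 0 R. \<forall>t \<in> {0..<T}. 0 \<le> u x t) \<and>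
     (\<forall>x \<in> ball 0 R. \<forall>t \<in> {0<..<T}.
        deriv (\<lambda>s. u x s) t = laplacian (\<lambda>y. u y t) x + norm x powr \<sigma> * u x t powr p) \<and>
     (\<forall>x \<in> sphere 0 R. \<forall>t \<in> {0<..<T}. u x t = 0) \<and>
     (\<forall>x \<in> ball 0 R. u x 0 = u0 x)"

definition maximal_existence_time ::
  "real \<Rightarrow> real \<Rightarrow> real \<Rightarrow> (real^'n \<Rightarrow> real) \<Rightarrow> real \<Rightarrow> (real^'n \<Rightarrow> real \<Rightarrow> real) \<Rightarrow> bool" where
  "maximal_existence_time R \<sigma> p u0 T u \<longleftrightarrow>
     nonneg_classical_solution R \<sigma> p u0 T u \<and>
     \<not> (\<exists>T' v. T < T' \<and> nonneg_classical_solution R \<sigma> p u0 T' v \<and>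
            (\<forall>x \<in> cball 0 R. \<forall>t \<in> {0..<T}. v x t = u x t))"

definition blows_up_at ::
  "real \<Rightarrow> real \<Rightarrow> real \<Rightarrow> (real^'n \<Rightarrow> real) \<Rightarrow> real \<Rightarrow> (real^'n \<Rightarrow> real \<Rightarrow> real) \<Rightarrow> bool" where
  "blows_up_at R \<sigma> p u0 T u \<longleftrightarrow>
     maximal_existence_time R \<sigma> p u0 T u \<and>
     ((\<lambda>t. Linf_norm (ball 0 R) (\<lambda>x. u x t)) \<longlongrightarrow> \<infinity>) (at_left T)"

definition blow_up_point ::
  "real \<Rightarrow> real \<Rightarrow> (real^'n \<Rightarrow> real \<Rightarrow> real) \<Rightarrow> real^'n \<Rightarrow> bool" where
  "blow_up_point R T u x \<longleftrightarrow>
     x \<in> cball 0 R \<and>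
     (\<exists>(xs :: nat \<Rightarrow> real^'n) (ts :: nat \<Rightarrow> real).
        (\<forall>j. xs j \<in> ball 0 R \<and> ts j \<in> {0<..<T}) \<and>
        xs \<longlonglongrightarrow> x \<and> ts \<longlonglongrightarrow> T \<and>
        filterlim (\<lambda>j. \<bar>u (xs j) (ts j)\<bar>) at_top sequentially)"

end

theory Submission
  imports Defs
begin

text \<open>The equation is read as a linear one, \<open>u\<^sub>t = \<Delta>u + V u\<close> with potential
  \<open>V = norm x powr \<sigma> * u powr (p - 1)\<close>.  The hypothesis on the limes superior says exactly that
  \<open>V \<le> \<delta> / (T - t)\<close> on \<open>ball 0 r\<close> for every \<open>\<delta> > 0\<close>, once \<open>t\<close> is close enough to \<open>T\<close>.  Then
  \<open>(T - t) powr \<delta> * u\<close> is a subsolution of the heat equation, hence bounded if boundary effects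
  are disregarded.  Thus \<open>u\<close> would grow at most like \<open>(T - t) powr (-\<delta>)\<close>; for
  \<open>\<delta> = 1 / (2 * (p - 1))\<close> this makes \<open>V\<close> at most a multiple of \<open>(T - t) powr (-1/2)\<close>, which is
  integrable in time, and a second application of the same principle bounds \<open>u\<close>.

  What makes this rigorous is the local estimate \<open>subsolution_interior_bound\<close>, in which the lateral
  boundary is absorbed by a barrier \<open>(\<rho>\<^sup>2 - (norm x)\<^sup>2) powr (-k)\<close>.  For \<open>k\<close> large the
  error it causes is integrable in time as soon as \<open>u\<close> is bounded by some power of
  \<open>1 / (T - t)\<close> in the shell \<open>\<rho>/2 \<le> norm x < \<rho>\<close>.  Away from the origin such a bound follows from
  the hypothesis, because the weight \<open>norm x powr (\<sigma> / (p - 1))\<close> is bounded below there.  The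
  estimate is applied on \<open>ball 0 r\<close> with the small critical potential and then on
  \<open>ball 0 (r/2)\<close> with the integrable one.\<close>

section \<open>Comparison of Laplacians at a point of contact\<close>

lemma second_derivative_nonpos_at_max:
  fixes g g' :: "real \<Rightarrow> real"
  assumes "e > 0"
    and g: "\<And>s. \<bar>s\<bar> < e \<Longrightarrow> (g has_real_derivative g' s) (at s)"
    and g': "(g' has_real_derivative D) (at 0)"
    and max: "\<And>s. \<bar>s\<bar> < e \<Longrightarrow> g s \<le> g 0"
  shows "D \<le> 0"
proof (rule ccontr)
  assume "\<not> D \<le> 0"
  then obtain d where "d > 0" and d: "\<And>h. 0 < h \<Longrightarrow> h < d \<Longrightarrow> g' 0 < g' h"
    using DERIV_pos_inc_right[OF g'] by auto
  have "g' 0 = 0"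
    using DERIV_local_max[OF g[of 0] \<open>e > 0\<close>] max \<open>e > 0\<close> by simp
  define s where "s = min d e / 2"
  have s: "0 < s" "s < d" "s < e"
    using \<open>d > 0\<close> \<open>e > 0\<close> by (auto simp: s_def)
  obtain z where "0 < z" "z < s" "g s - g 0 = (s - 0) * g' z"
    using MVT2[of 0 s g g'] g s by (auto simp: abs_if)
  moreover have "g' z > 0"
    using d[of z] \<open>0 < z\<close> \<open>z < s\<close> s \<open>g' 0 = 0\<close> by simp
  ultimately have "g s > g 0"
    using s by (smt (verit) mult_pos_pos)
  with max[of s] s show False by simp
qed

text \<open>The comparison function is given only through its restriction \<open>q\<close> to the line through
  \<open>x\<close> in direction \<open>i\<close>, so that its second derivative can be supplied explicitly.\<close>

lemma partial_deriv2_le_at_contact: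
  fixes f :: "real^'n \<Rightarrow> real"
  assumes "e > 0"
    and f1: "\<And>y. y \<in> ball x e \<Longrightarrow> partial_differentiable_at i f y"
    and f2: "partial_differentiable_at i (partial_deriv i f) x"
    and q1: "\<And>s. \<bar>s\<bar> < e \<Longrightarrow> (q has_real_derivative q' s) (at s)"
    and q2: "(q' has_real_derivative D) (at 0)"
    and le: "\<And>s. \<bar>s\<bar> < e \<Longrightarrow> f (x + s *\<^sub>R axis i 1) \<le> q s"
    and eq: "f x = q 0"
  shows "partial_deriv i (partial_deriv i f) x \<le> D"
proof -
  have 1: "((\<lambda>s. f (x + s *\<^sub>R axis i 1)) has_real_derivative
      partial_deriv i f (x + s *\<^sub>R axis i 1)) (at s)" if "\<bar>s\<bar> < e" for s
  proof -
    have "partial_differentiable_at i f (x + s *\<^sub>R axis i 1)"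
      using that by (intro f1) (simp add: dist_norm)
    then have "((\<lambda>h. f (x + s *\<^sub>R axis i 1 + h *\<^sub>R axis i 1)) has_real_derivative
        partial_deriv i f (x + s *\<^sub>R axis i 1)) (at 0)"
      unfolding partial_differentiable_at_def partial_deriv_def
      by (simp add: DERIV_deriv_iff_real_differentiable)
    then show ?thesis
      using DERIV_at_within_shift[of "\<lambda>s. f (x + s *\<^sub>R axis i 1)" _ s 0 UNIV]
      by (simp add: algebra_simps)
  qed
  have 2: "((\<lambda>s. partial_deriv i f (x + s *\<^sub>R axis i 1)) has_real_derivative
      partial_deriv i (partial_deriv i f) x) (at 0)"
    using f2 unfolding partial_differentiable_at_def partial_deriv_def[of i "partial_deriv i f"]
    by (simp add: DERIV_deriv_iff_real_differentiable)
  have "partial_deriv i (partial_deriv i f) x - D \<le> 0"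
    by (rule second_derivative_nonpos_at_max[OF \<open>e > 0\<close>,
          where g = "\<lambda>s. f (x + s *\<^sub>R axis i 1) - q s"
            and g' = "\<lambda>s. partial_deriv i f (x + s *\<^sub>R axis i 1) - q' s"])
      (use 1 2 q1 q2 le eq in \<open>auto intro!: DERIV_diff\<close>)
  then show ?thesis by simp
qed

lemma norm_add_axis_sq:
  fixes x :: "real^'n"
  shows "(norm (x + s *\<^sub>R axis i 1))\<^sup>2 = (norm x)\<^sup>2 + 2 * s * x $ i + s\<^sup>2"
proof -
  have "x \<bullet> axis i 1 = x $ i" "axis i 1 \<bullet> x = x $ i" "axis i (1::real) \<bullet> axis i 1 = (1::real)"
    by (simp_all add: inner_axis inner_axis')
  then show ?thesis
    unfolding power2_norm_eq_inner
    by (simp add: inner_add_left inner_add_right power2_eq_square algebra_simps)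
qed

text \<open>The barrier \<open>h x = (\<rho>\<^sup>2 - (norm x)\<^sup>2) powr (-k)\<close> is infinite on the sphere of radius
  \<open>\<rho>\<close> and satisfies \<open>\<Delta>h \<le> C * h powr (1 + 2/k)\<close>; the power \<open>2/k\<close> of \<open>h\<close> appears below as
  \<open>(\<rho>\<^sup>2 - (norm x)\<^sup>2) powr (-2)\<close>.  A function touching a multiple of \<open>h\<close> from below inherits the
  bound on its Laplacian.\<close>

lemma laplacian_le_at_barrier_contact:
  fixes f :: "real^'n \<Rightarrow> real"
  assumes "x \<in> ball 0 \<rho>" and "k > 0" and "c \<ge> 0"
    and f1: "\<And>i y. y \<in> ball 0 \<rho> \<Longrightarrow> partial_differentiable_at i f y"
    and f2: "\<And>i. partial_differentiable_at i (partial_deriv i f) x"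
    and le: "\<And>y. y \<in> ball 0 \<rho> \<Longrightarrow> f y \<le> c * (\<rho>\<^sup>2 - (norm y)\<^sup>2) powr (-k)"
    and eq: "f x = c * (\<rho>\<^sup>2 - (norm x)\<^sup>2) powr (-k)"
  shows "laplacian f x \<le>
    (2 * k * real CARD('n) + 4 * k * (k + 1)) * \<rho>\<^sup>2 * (\<rho>\<^sup>2 - (norm x)\<^sup>2) powr (-2) * f x"
proof -
  define b where "b = \<rho>\<^sup>2 - (norm x)\<^sup>2"
  define w where "w i s = b - 2 * s * x $ i - s\<^sup>2" for i s
  define e where "e = \<rho> - norm x"
  have "e > 0" using assms(1) by (simp add: e_def)
  have in_ball: "y \<in> ball 0 \<rho>" if "y \<in> ball x e" for y
    using that norm_triangle_ineq2[of y x] by (simp add: e_def dist_norm norm_minus_commute)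
  have line: "x + s *\<^sub>R axis i 1 \<in> ball 0 \<rho>" if "\<bar>s\<bar> < e" for i s
    using that by (intro in_ball) (simp add: dist_norm)
  have w_eq: "\<rho>\<^sup>2 - (norm (x + s *\<^sub>R axis i 1))\<^sup>2 = w i s" for i s
    unfolding norm_add_axis_sq w_def b_def by simp
  have pos: "\<rho>\<^sup>2 - (norm y)\<^sup>2 > 0" if "y \<in> ball 0 \<rho>" for y :: "real^'n"
    using that by (simp add: power_strict_mono)
  have w_pos: "w i s > 0" if "\<bar>s\<bar> < e" for i s
    using pos[OF line[OF that]] w_eq by metis
  have "b > 0" using pos[OF assms(1)] by (simp add: b_def)
  have dw: "(w i has_real_derivative - (2 * x $ i + 2 * s)) (at s)" for i s
    unfolding w_def by (auto intro!: derivative_eq_intros)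
  have dpow: "((\<lambda>s. w i s powr m) has_real_derivative
      m * w i s powr (m - 1) * - (2 * x $ i + 2 * s)) (at s)" if "\<bar>s\<bar> < e" for i s m
    by (rule DERIV_chain2[OF has_real_derivative_powr[OF w_pos[OF that]] dw])
  have partial: "partial_deriv i (partial_deriv i f) x
      \<le> c * k * (2 * b powr (-k-1) + 4 * (k + 1) * (x $ i)\<^sup>2 * b powr (-k-2))" for i
  proof (rule partial_deriv2_le_at_contact[OF \<open>e > 0\<close>])
    show "((\<lambda>s. c * w i s powr (-k)) has_real_derivative
        c * k * (2 * x $ i + 2 * s) * w i s powr (-k-1)) (at s)" if "\<bar>s\<bar> < e" for s
      by (rule DERIV_cong[OF DERIV_cmult[OF dpow[OF that]]]) (simp add: algebra_simps)
    show "((\<lambda>s. c * k * (2 * x $ i + 2 * s) * w i s powr (-k-1)) has_real_derivative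
        c * k * (2 * b powr (-k-1) + 4 * (k + 1) * (x $ i)\<^sup>2 * b powr (-k-2))) (at 0)"
    proof (rule DERIV_cong[OF DERIV_mult[OF _ dpow]])
      show "((\<lambda>s. c * k * (2 * x $ i + 2 * s)) has_real_derivative c * k * 2) (at 0)"
        by (auto intro!: derivative_eq_intros)
    qed (use \<open>e > 0\<close> in \<open>auto simp: w_def algebra_simps power2_eq_square\<close>)
  qed (use f1 f2 in_ball le[OF line] eq w_eq in \<open>auto simp: b_def w_def\<close>)
  have "laplacian f x \<le> (\<Sum>i\<in>UNIV. c * k * (2 * b powr (-k-1) + 4 * (k + 1) * (x $ i)\<^sup>2 * b powr (-k-2)))"
    unfolding laplacian_def by (intro sum_mono partial)
  also have "\<dots> = c * k * (2 * real CARD('n) * b powr (-k-1) + 4 * (k + 1) * (norm x)\<^sup>2 * b powr (-k-2))"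
    unfolding power2_norm_eq_inner inner_vec_def
    by (simp add: sum.distrib power2_eq_square flip: sum_distrib_left sum_distrib_right)
  also have "\<dots> = c * k * (2 * real CARD('n) * b + 4 * (k + 1) * (norm x)\<^sup>2) * b powr (-k-2)"
    using \<open>b > 0\<close> by (simp add: powr_diff field_simps power2_eq_square)
  also have "\<dots> \<le> c * k * (2 * real CARD('n) * \<rho>\<^sup>2 + 4 * (k + 1) * \<rho>\<^sup>2) * b powr (-k-2)"
    using assms \<open>b > 0\<close>
    by (intro mult_right_mono mult_left_mono add_mono) (auto simp: b_def)
  also have "\<dots> = (2 * k * real CARD('n) + 4 * k * (k + 1)) * \<rho>\<^sup>2 * b powr (-2) * f x"
    using powr_add[of b "-k" "-2"] by (simp add: eq algebra_simps flip: b_def)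
  finally show ?thesis by (simp add: b_def)
qed

section \<open>Interior bounds for subsolutions\<close>

lemma exists_first_contact:
  fixes f :: "'a::euclidean_space \<times> real \<Rightarrow> real"
  assumes cont: "continuous_on (K \<times> {t0..t2}) f" and "compact K"
    and init: "\<And>x. x \<in> K \<Longrightarrow> f (x, t0) < 0"
    and "x2 \<in> K" "t0 \<le> t2" "f (x2, t2) \<ge> 0"
  obtains x1 t1 where "x1 \<in> K" "t0 < t1" "t1 \<le> t2" "f (x1, t1) = 0"
    "\<And>x. x \<in> K \<Longrightarrow> f (x, t1) \<le> 0" "\<And>t. t0 \<le> t \<Longrightarrow> t < t1 \<Longrightarrow> f (x1, t) < 0"
proof -
  define Z where "Z = {z \<in> K \<times> {t0..t2}. f z \<in> {0..}}"
  have cK: "compact (K \<times> {t0..t2})"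
    using \<open>compact K\<close> by (intro compact_Times) auto
  have "closed Z"
    unfolding Z_def using cont cK by (intro continuous_closed_preimage[unfolded vimage_def Int_def, simplified] ) (auto intro: compact_imp_closed)
  moreover have "K \<times> {t0..t2} \<inter> Z = Z"
    by (auto simp: Z_def)
  ultimately have "compact Z"
    using compact_Int_closed[OF cK] by metis
  moreover have "(x2, t2) \<in> Z" using assms by (simp add: Z_def)
  moreover have "continuous_on Z snd" by (intro continuous_intros)
  ultimately obtain z1 where "z1 \<in> Z" and min: "\<And>z. z \<in> Z \<Longrightarrow> snd z1 \<le> snd z"
    using continuous_attains_inf[of Z snd] by blast
  obtain x1 t1 where z1: "z1 = (x1, t1)" by (cases z1)
  have 1: "x1 \<in> K" "t0 \<le> t1" "t1 \<le> t2" "f (x1, t1) \<ge> 0"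
    using \<open>z1 \<in> Z\<close> by (auto simp: Z_def z1)
  then have "t0 < t1" using init[of x1] by (cases "t0 = t1") auto
  have neg: "f (x, t) < 0" if "x \<in> K" "t0 \<le> t" "t < t1" for x t
    using min[of "(x, t)"] that 1 by (force simp: Z_def z1)
  have le: "f (x, t1) \<le> 0" if "x \<in> K" for x
  proof -
    have "continuous_on {t0..t1} (\<lambda>t. f (x, t))"
      by (rule continuous_on_compose2[OF cont]) (use that 1 in \<open>auto intro!: continuous_intros\<close>)
    then have "((\<lambda>t. f (x, t)) \<longlongrightarrow> f (x, t1)) (at_left t1)"
      using \<open>t0 < t1\<close> by (rule continuous_on_Icc_at_leftD)
    moreover have "\<forall>\<^sub>F t in at_left t1. f (x, t) \<le> 0"
      using eventually_at_left_real[OF \<open>t0 < t1\<close>]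
      by eventually_elim (use neg that in \<open>auto intro: less_imp_le\<close>)
    ultimately show ?thesis
      by (intro tendsto_upperbound) auto
  qed
  show ?thesis
    using that[of x1 t1] 1 \<open>t0 < t1\<close> le neg by (simp add: order_antisym)
qed

lemma C21_onD:
  assumes "C21_on \<Omega> T u" "x \<in> \<Omega>" "t \<in> {0<..<T}"
  shows "((\<lambda>s. u x s) has_real_derivative deriv (\<lambda>s. u x s) t) (at t)"
    and "partial_differentiable_at i (\<lambda>y. u y t) x"
    and "partial_differentiable_at i (partial_deriv i (\<lambda>y. u y t)) x"
  using assms by (auto simp: C21_on_def Let_def DERIV_deriv_iff_real_differentiable)

text \<open>A subsolution of \<open>u\<^sub>t = \<Delta>u + V u\<close> with \<open>V = \<delta>/(T - t) + A/sqrt (T - t)\<close> grows in the inner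
  ball at most at the rate \<open>(T - t) powr (-\<delta>)\<close> dictated by the critical part of \<open>V\<close>, whatever
  power \<open>a\<close> bounds it in the outer shell.  The proof compares \<open>u\<close> with \<open>G t * h x\<close>, where
  \<open>h\<close> is the barrier with exponent \<open>k = 4 * a\<close> and
  \<open>G t = \<Lambda> * (T - t) powr (-\<delta>) * exp (- 2 * L * sqrt (T - t))\<close>.  At a first contact in the
  outer shell \<open>h \<le> G t * h = u \<le> M * (T - t) powr (-a)\<close>, so the factor \<open>h powr (2/k)\<close> in
  \<open>\<Delta>h \<le> C * h powr (2/k) * h\<close> is at most a constant times the integrable function
  \<open>(T - t) powr (-1/2)\<close>; in the inner ball it is bounded.  Hence \<open>G * h\<close> is a strict supersolution
  wherever contact could occur, once \<open>L\<close> is large.\<close>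

lemma subsolution_interior_bound:
  fixes u :: "real^'n \<Rightarrow> real \<Rightarrow> real"
  assumes "0 < \<rho>" "0 < t0" "t0 < T" "0 \<le> \<delta>" "0 < a" "0 \<le> A" "0 \<le> M"
    and cont: "continuous_on (cball 0 \<rho> \<times> {t0..<T}) (\<lambda>(x, t). u x t)"
    and reg: "C21_on \<Omega> T u" and sub: "ball 0 \<rho> \<subseteq> \<Omega>"
    and ineq: "\<And>x t. x \<in> ball 0 \<rho> \<Longrightarrow> t0 < t \<Longrightarrow> t < T \<Longrightarrow>
      deriv (\<lambda>s. u x s) t \<le> laplacian (\<lambda>y. u y t) x + (\<delta> / (T - t) + A * (T - t) powr (-1/2)) * u x t"
    and outer: "\<And>x t. x \<in> ball 0 \<rho> \<Longrightarrow> \<rho> / 2 \<le> norm x \<Longrightarrow> t0 < t \<Longrightarrow> t < T \<Longrightarrow>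
      u x t \<le> M * (T - t) powr (-a)"
  obtains C where "C \<ge> 0" "\<And>x t. x \<in> ball 0 (\<rho>/2) \<Longrightarrow> t0 \<le> t \<Longrightarrow> t < T \<Longrightarrow> u x t \<le> C * (T - t) powr (-\<delta>)"
proof -
  \<comment> \<open>The choice \<open>k = 4 * a\<close> makes \<open>(T - t) powr (-a)\<close> to the power \<open>2/k\<close> equal to
    \<open>(T - t) powr (-1/2)\<close>.\<close>
  define k where "k = 4 * a"
  define C0 where "C0 = (2 * k * real CARD('n) + 4 * k * (k + 1)) * \<rho>\<^sup>2"
  define B where "B = M powr (1 / (2 * a)) + (3/4 * \<rho>\<^sup>2) powr (-2) * T powr (1/2)"
  define L where "L = A + C0 * B + 1"
  have "k > 0" using \<open>0 < a\<close> by (simp add: k_def)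
  then have "C0 \<ge> 0" by (simp add: C0_def)
  have "B \<ge> 0" by (simp add: B_def)
  have "L > 0" using \<open>C0 \<ge> 0\<close> \<open>B \<ge> 0\<close> \<open>0 \<le> A\<close> by (simp add: L_def add_nonneg_pos)
  have "continuous_on (cball 0 \<rho>) (\<lambda>x. u x t0)"
    by (rule continuous_on_compose2[OF cont, of _ "\<lambda>x. (x, t0)", simplified])
      (use \<open>t0 < T\<close> in \<open>auto intro!: continuous_intros\<close>)
  then have "bdd_above ((\<lambda>x. u x t0) ` cball 0 \<rho>)"
    by (intro bounded_imp_bdd_above compact_imp_bounded compact_continuous_image) auto
  then obtain U0 where U0: "\<And>x. x \<in> cball 0 \<rho> \<Longrightarrow> u x t0 \<le> U0"
    unfolding bdd_above_def by blast
  define U where "U = max U0 0"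
  have "U \<ge> 0" and U: "\<And>x. x \<in> cball 0 \<rho> \<Longrightarrow> u x t0 \<le> U"
    using U0 by (force simp: U_def)+
  \<comment> \<open>The constant \<open>\<Lambda>\<close> puts the comparison function above \<open>u\<close> at time \<open>t0\<close> and keeps
    \<open>G \<ge> 1\<close> throughout.\<close>
  define \<Lambda> where "\<Lambda> = (1 + U * (\<rho>\<^sup>2) powr k) * T powr \<delta> * exp (2 * L * T powr (1/2))"
  define G where "G t = \<Lambda> * (T - t) powr (-\<delta>) * exp (- (2 * L * (T - t) powr (1/2)))" for t
  have "\<Lambda> \<ge> 0" using \<open>U \<ge> 0\<close> by (simp add: \<Lambda>_def)
  have G_ge: "1 + U * (\<rho>\<^sup>2) powr k \<le> G t" if "t0 \<le> t" "t < T" for t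
  proof -
    have "1 \<le> (T / (T - t)) powr \<delta>"
      using that assms by (intro ge_one_powr_ge_zero) auto
    moreover have "1 \<le> exp (2 * L * T powr (1/2) - 2 * L * (T - t) powr (1/2))"
      using that assms \<open>L > 0\<close> by (auto intro!: mult_left_mono powr_mono2)
    ultimately have "1 * 1 \<le> (T / (T - t)) powr \<delta> * exp (2 * L * T powr (1/2) - 2 * L * (T - t) powr (1/2))"
      by (intro mult_mono) auto
    also have "\<dots> = T powr \<delta> * exp (2 * L * T powr (1/2)) * (T - t) powr (-\<delta>) * exp (- (2 * L * (T - t) powr (1/2)))"
      using that assms by (simp add: powr_divide powr_minus field_simps exp_diff exp_minus)
    finally have "(1 + U * (\<rho>\<^sup>2) powr k) * 1 \<le> (1 + U * (\<rho>\<^sup>2) powr k) * \<dots>"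
      using \<open>U \<ge> 0\<close> by (intro mult_left_mono) auto
    then show ?thesis by (simp add: G_def \<Lambda>_def mult_ac)
  qed
  have G_ge1: "1 \<le> G t" if "t0 \<le> t" "t < T" for t
    using G_ge[OF that] \<open>U \<ge> 0\<close> by (smt (verit) mult_nonneg_nonneg powr_ge_zero)
  have dG: "(G has_real_derivative G t * (\<delta> / (T - t) + L * (T - t) powr (-1/2))) (at t)" if "t < T" for t
  proof -
    have dpow: "((\<lambda>t. (T - t) powr m) has_real_derivative m * (T - t) powr (m - 1) * - 1) (at t)" for m
      by (rule DERIV_chain2[OF has_real_derivative_powr])
        (use that in \<open>auto intro!: derivative_eq_intros\<close>)
    show ?thesis
      unfolding G_def
      by (rule DERIV_cong[OF DERIV_mult[OF DERIV_cmult[OF dpow]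
            DERIV_chain2[OF DERIV_exp DERIV_minus[OF DERIV_cmult[OF dpow]]]]])
        (use that in \<open>simp add: powr_diff algebra_simps\<close>)
  qed
  \<comment> \<open>The inequality \<open>u < G * h\<close> multiplied by \<open>1 / h\<close>, which extends continuously (by 0) to the
    sphere of radius \<open>\<rho>\<close>.\<close>
  define f where "f = (\<lambda>(x, t). u x t * (\<rho>\<^sup>2 - (norm x)\<^sup>2) powr k - G t)"
  have b_pos: "\<rho>\<^sup>2 - (norm x)\<^sup>2 > 0" if "x \<in> ball 0 \<rho>" for x :: "real^'n"
    using that by (simp add: power_strict_mono)
  have b_nonneg: "\<rho>\<^sup>2 - (norm x)\<^sup>2 \<ge> 0" if "x \<in> cball 0 \<rho>" for x :: "real^'n"
    using that by (simp add: power_mono)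
  have b_inner: "3/4 * \<rho>\<^sup>2 \<le> \<rho>\<^sup>2 - (norm x)\<^sup>2" if "norm x \<le> \<rho> / 2" for x :: "real^'n"
    using power_mono[OF that, of 2] by (simp add: field_simps)
  have f_neg: "f (x2, t2) < 0" if x2: "x2 \<in> cball 0 \<rho>" and t2: "t0 \<le> t2" "t2 < T" for x2 t2
  proof (rule ccontr)
    assume "\<not> f (x2, t2) < 0"
    have "continuous_on (cball 0 \<rho> \<times> {t0..t2}) (\<lambda>(x, t). u x t)"
      by (rule continuous_on_subset[OF cont]) (use t2 in auto)
    moreover have "continuous_on {t0..t2} G"
      using DERIV_isCont[OF dG] \<open>t2 < T\<close> by (intro continuous_at_imp_continuous_on) auto
    then have "continuous_on (cball (0::real^'n) \<rho> \<times> {t0..t2}) (\<lambda>z. G (snd z))"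
      by (rule continuous_on_compose2) (auto intro!: continuous_intros)
    moreover have "continuous_on (cball (0::real^'n) \<rho> \<times> {t0..t2}) (\<lambda>z. (\<rho>\<^sup>2 - (norm (fst z))\<^sup>2) powr k)"
      using b_nonneg \<open>k > 0\<close> by (intro continuous_on_powr' continuous_intros) auto
    ultimately have f_cont: "continuous_on (cball 0 \<rho> \<times> {t0..t2}) f"
      unfolding f_def case_prod_unfold by (intro continuous_on_diff continuous_on_mult)
    have init: "f (x, t0) < 0" if "x \<in> cball 0 \<rho>" for x
    proof -
      have "u x t0 * (\<rho>\<^sup>2 - (norm x)\<^sup>2) powr k \<le> U * (\<rho>\<^sup>2) powr k"
        using U[OF that] \<open>U \<ge> 0\<close> b_nonneg[OF that] \<open>k > 0\<close>
        by (intro mult_mono powr_mono2) auto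
      then show ?thesis using G_ge[of t0] \<open>t0 < T\<close> by (simp add: f_def)
    qed
    obtain x1 t1 where x1: "x1 \<in> cball 0 \<rho>" and t1: "t0 < t1" "t1 \<le> t2" and
      f0: "f (x1, t1) = 0" and max: "\<And>x. x \<in> cball 0 \<rho> \<Longrightarrow> f (x, t1) \<le> 0" and
      before: "\<And>t. t0 \<le> t \<Longrightarrow> t < t1 \<Longrightarrow> f (x1, t) < 0"
      using exists_first_contact[OF f_cont compact_cball init x2 t2(1)] \<open>\<not> f (x2, t2) < 0\<close>
      by (metis not_less)
    have "t1 < T" "0 < t1" using t1 t2 \<open>0 < t0\<close> by auto
    have "G t1 \<ge> 1" using G_ge1[of t1] t1 \<open>t1 < T\<close> by simp
    define b where "b = \<rho>\<^sup>2 - (norm x1)\<^sup>2"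
    define \<tau> where "\<tau> = T - t1"
    have "\<tau> > 0" "\<tau> \<le> T" using \<open>t1 < T\<close> \<open>0 < t1\<close> by (auto simp: \<tau>_def)
    have ub: "u x1 t1 * b powr k = G t1" using f0 by (simp add: f_def b_def)
    have "b \<noteq> 0" using ub \<open>G t1 \<ge> 1\<close> by auto
    then have "norm x1 \<noteq> \<rho>" by (auto simp: b_def)
    then have x1': "x1 \<in> ball 0 \<rho>" using x1 by simp
    then have "b > 0" using b_pos by (simp add: b_def)
    have u_eq: "u x1 t1 = G t1 * b powr (-k)"
      using ub \<open>b > 0\<close> by (simp add: powr_minus field_simps)
    then have "u x1 t1 > 0" using \<open>G t1 \<ge> 1\<close> \<open>b > 0\<close> by simp
    have lap: "laplacian (\<lambda>y. u y t1) x1 \<le> C0 * b powr (-2) * u x1 t1"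
      unfolding C0_def b_def
    proof (rule laplacian_le_at_barrier_contact[OF x1' \<open>k > 0\<close>, where c = "G t1"])
      show "u y t1 \<le> G t1 * (\<rho>\<^sup>2 - (norm y)\<^sup>2) powr (-k)" if "y \<in> ball 0 \<rho>" for y
        using max[of y] that b_pos[OF that] by (simp add: f_def powr_minus field_simps)
    qed (use C21_onD[OF reg] sub x1' \<open>0 < t1\<close> \<open>t1 < T\<close> \<open>G t1 \<ge> 1\<close> u_eq in \<open>auto simp: b_def\<close>)
    have time: "G t1 * (\<delta> / \<tau> + L * \<tau> powr (-1/2)) \<le> deriv (\<lambda>s. u x1 s) t1 * b powr k"
    proof (rule ccontr)
      assume "\<not> ?thesis"
      then have neg: "deriv (\<lambda>s. u x1 s) t1 * b powr k - G t1 * (\<delta> / \<tau> + L * \<tau> powr (-1/2)) < 0"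
        by linarith
      have "((\<lambda>t. f (x1, t)) has_real_derivative
        deriv (\<lambda>s. u x1 s) t1 * b powr k - G t1 * (\<delta> / \<tau> + L * \<tau> powr (-1/2))) (at t1)"
        unfolding f_def \<tau>_def b_def prod.case
        using C21_onD(1)[OF reg, of x1 t1] sub x1' \<open>0 < t1\<close> \<open>t1 < T\<close>
        by (intro DERIV_diff dG DERIV_cmult_right) auto
      from DERIV_neg_dec_left[OF this neg] obtain d where "d > 0" and d: "\<And>h. 0 < h \<Longrightarrow> h < d \<Longrightarrow> f (x1, t1) < f (x1, t1 - h)"
        by blast
      define h where "h = min d (t1 - t0) / 2"
      have "0 < h" "h < d" "t0 \<le> t1 - h" using \<open>d > 0\<close> t1 by (auto simp: h_def min_def field_simps)
      then show False using d[of h] before[of "t1 - h"] f0 by simp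
    qed
    have b2: "b powr (-2) \<le> B * \<tau> powr (-1/2)"
    proof (cases "norm x1 < \<rho> / 2")
      case True
      have "b powr (-2) \<le> (3/4 * \<rho>\<^sup>2) powr (-2) * 1"
        using b_inner[of x1] True \<open>\<rho> > 0\<close> \<open>b > 0\<close> by (auto intro!: powr_mono2' simp: b_def)
      also have "\<dots> \<le> (3/4 * \<rho>\<^sup>2) powr (-2) * (T powr (1/2) * \<tau> powr (-1/2))"
      proof (intro mult_left_mono)
        have "1 \<le> (T / \<tau>) powr (1/2)"
          using \<open>\<tau> > 0\<close> \<open>\<tau> \<le> T\<close> by (intro ge_one_powr_ge_zero) auto
        also have "\<dots> = T powr (1/2) / \<tau> powr (1/2)"
          by (rule powr_divide)
        also have "\<dots> = T powr (1/2) * \<tau> powr (-1/2)"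
          using powr_minus_divide[of \<tau> "1/2"] by simp
        finally show "1 \<le> T powr (1/2) * \<tau> powr (-1/2)" .
      qed auto
      also have "\<dots> = ((3/4 * \<rho>\<^sup>2) powr (-2) * T powr (1/2)) * \<tau> powr (-1/2)"
        by (simp only: mult.assoc)
      also have "\<dots> \<le> B * \<tau> powr (-1/2)"
        unfolding B_def by (intro mult_right_mono) auto
      finally show ?thesis .
    next
      case False
      have "b powr (-k) \<le> G t1 * b powr (-k)"
        using \<open>G t1 \<ge> 1\<close> by (simp add: mult_le_cancel_right1)
      also have "\<dots> \<le> M * \<tau> powr (-a)"
        using outer[of x1 t1] x1' False t1 \<open>t1 < T\<close> u_eq by (simp add: \<tau>_def)
      finally have "(b powr (-k)) powr (1/(2*a)) \<le> (M * \<tau> powr (-a)) powr (1/(2*a))"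
        using \<open>0 < a\<close> by (intro powr_mono2) auto
      then have "b powr (-2) \<le> M powr (1/(2*a)) * \<tau> powr (-1/2)"
        using \<open>0 < a\<close> \<open>0 \<le> M\<close> by (simp add: powr_powr powr_mult k_def)
      also have "\<dots> \<le> B * \<tau> powr (-1/2)"
        unfolding B_def by (intro mult_right_mono) auto
      finally show ?thesis .
    qed
    have "(\<delta> / \<tau> + L * \<tau> powr (-1/2)) * u x1 t1 \<le> deriv (\<lambda>s. u x1 s) t1"
      using time \<open>b > 0\<close> by (simp add: u_eq powr_minus field_simps)
    also have "\<dots> \<le> C0 * b powr (-2) * u x1 t1 + (\<delta> / \<tau> + A * \<tau> powr (-1/2)) * u x1 t1"
      using ineq[OF x1' \<open>t0 < t1\<close> \<open>t1 < T\<close>] lap by (simp add: \<tau>_def)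
    also have "\<dots> \<le> C0 * (B * \<tau> powr (-1/2)) * u x1 t1 + (\<delta> / \<tau> + A * \<tau> powr (-1/2)) * u x1 t1"
      using b2 \<open>C0 \<ge> 0\<close> \<open>u x1 t1 > 0\<close> by (intro add_right_mono mult_right_mono mult_left_mono) auto
    also have "\<dots> = (\<delta> / \<tau> + L * \<tau> powr (-1/2)) * u x1 t1 - \<tau> powr (-1/2) * u x1 t1"
      by (simp add: L_def algebra_simps)
    finally have "\<tau> powr (-1/2) * u x1 t1 \<le> 0" by simp
    with \<open>u x1 t1 > 0\<close> \<open>\<tau> > 0\<close> show False
      by (simp add: mult_le_0_iff)
  qed
  show ?thesis
  proof (rule that)
    show "\<Lambda> * (3/4 * \<rho>\<^sup>2) powr (-k) \<ge> 0" using \<open>\<Lambda> \<ge> 0\<close> by simp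
    fix x :: "real^'n" and t assume x: "x \<in> ball 0 (\<rho>/2)" and t: "t0 \<le> t" "t < T"
    define b where "b = \<rho>\<^sup>2 - (norm x)\<^sup>2"
    have b: "3/4 * \<rho>\<^sup>2 \<le> b" using b_inner[of x] x by (simp add: b_def)
    have "0 < 3/4 * \<rho>\<^sup>2" using \<open>\<rho> > 0\<close> by simp
    also note b
    finally have "b > 0" .
    have "f (x, t) < 0" using f_neg[of x t] x t \<open>\<rho> > 0\<close> by simp
    then have "u x t \<le> G t * b powr (-k)"
      using \<open>b > 0\<close> by (simp add: f_def powr_minus field_simps b_def)
    also have "\<dots> \<le> (\<Lambda> * (T - t) powr (-\<delta>) * 1) * (3/4 * \<rho>\<^sup>2) powr (-k)"
      unfolding G_def using \<open>0 \<le> \<delta>\<close> t \<open>\<Lambda> \<ge> 0\<close> \<open>L > 0\<close> \<open>k > 0\<close> b \<open>\<rho> > 0\<close>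
      by (intro mult_mono powr_mono2') auto
    finally show "u x t \<le> \<Lambda> * (3/4 * \<rho>\<^sup>2) powr (-k) * (T - t) powr (-\<delta>)"
      by (simp add: mult_ac)
  qed
qed

section \<open>The type I bound with small constant\<close>

lemma abs_le_of_Linf_norm_le:
  fixes f :: "real^'n \<Rightarrow> real"
  assumes "open S" and cont: "continuous_on S f" and le: "Linf_norm S f \<le> ereal c" and "x \<in> S"
  shows "\<bar>f x\<bar> \<le> c"
proof -
  define N where "N = {y \<in> S. c < \<bar>f y\<bar>}"
  have S: "S \<in> sets lebesgue" using \<open>open S\<close> by simp
  have "AE y in lebesgue_on S. ereal \<bar>f y\<bar> \<le> Linf_norm S f"
    unfolding Linf_norm_def by (rule esssup_AE)
  then have "AE y in lebesgue. y \<in> S \<longrightarrow> ereal \<bar>f y\<bar> \<le> Linf_norm S f"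
    using S by (simp add: AE_restrict_space_iff)
  then have "AE y in lebesgue. y \<notin> N"
    by eventually_elim (use le in \<open>force simp: N_def dest: order_trans\<close>)
  have "open (S \<inter> (\<lambda>y. \<bar>f y\<bar>) -` {c<..})"
    using \<open>open S\<close> cont by (intro continuous_open_preimage continuous_intros) auto
  then have "open N"
    by (simp add: N_def vimage_def Int_def)
  moreover have "negligible N"
    using \<open>AE y in lebesgue. y \<notin> N\<close> \<open>open N\<close>
    by (simp add: negligible_iff_null_sets AE_iff_null_sets)
  ultimately have "N = {}" using open_not_negligible by blast
  then show ?thesis using \<open>x \<in> S\<close> by (force simp: N_def)
qed

section \<open>Boundedness near the origin\<close>

theorem theorem1p3:
  fixes u :: "real^'n \<Rightarrow> real \<Rightarrow> real"
    and u0 :: "real^'n \<Rightarrow> real"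
    and R \<sigma> p T r :: real
  assumes "\<sigma> > 0"
    and "R > 0"
    and "p > 1 + \<sigma> / real CARD('n)"
    and "admissible_initial_data R u0"
    and "T > 0"
    and "blows_up_at R \<sigma> p u0 T u"
    and "0 < r" and "r < R"
    and "Limsup (at_left T)
           (\<lambda>t. ereal ((T - t) powr (1 / (p - 1))) *
                Linf_norm (ball 0 r) (\<lambda>x. norm x powr (\<sigma> / (p - 1)) * u x t)) = 0"
  shows "\<not> blow_up_point R T u 0"
proof
  assume blowup: "blow_up_point R T u 0"
  have "p > 1"
  proof -
    have "\<sigma> / real CARD('n) > 0" using \<open>\<sigma> > 0\<close> by simp
    with assms(3) show ?thesis by linarith
  qed
  define q where "q = 1 / (p - 1)"
  have "q > 0" using \<open>p > 1\<close> by (simp add: q_def)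
  \<comment> \<open>With this \<open>\<epsilon>\<close> the potential \<open>norm x powr \<sigma> * u x t powr (p - 1)\<close> is at most
    \<open>\<delta> / (T - t)\<close> for \<open>\<delta> = q / 2\<close>, and the resulting rate satisfies \<open>\<delta> * (p - 1) = 1/2 < 1\<close>.\<close>
  define \<epsilon> where "\<epsilon> = (1/2 * q) powr q"
  have "\<epsilon> > 0" using \<open>q > 0\<close> by (simp add: \<epsilon>_def)
  have sol: "nonneg_classical_solution R \<sigma> p u0 T u"
    using assms(6) by (simp add: blows_up_at_def maximal_existence_time_def)
  have cont: "continuous_on (cball 0 R \<times> {0..<T}) (\<lambda>(x, t). u x t)"
    and reg: "C21_on (ball 0 R) T u"
    and nonneg: "\<And>x t. x \<in> cball 0 R \<Longrightarrow> 0 \<le> t \<Longrightarrow> t < T \<Longrightarrow> 0 \<le> u x t"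
    and eqn: "\<And>x t. x \<in> ball 0 R \<Longrightarrow> 0 < t \<Longrightarrow> t < T \<Longrightarrow>
        deriv (\<lambda>s. u x s) t = laplacian (\<lambda>y. u y t) x + norm x powr \<sigma> * u x t powr p"
    using sol by (auto simp: nonneg_classical_solution_def)

  \<comment> \<open>Here \<open>\<sigma> * q\<close> is the weight exponent \<open>\<sigma> / (p - 1)\<close>.\<close>
  have "\<forall>\<^sub>F t in at_left T. ereal ((T - t) powr q) *
      Linf_norm (ball 0 r) (\<lambda>x. norm x powr (\<sigma> * q) * u x t) < ereal \<epsilon>"
    using assms(9) \<open>\<epsilon> > 0\<close> by (intro Limsup_lessD) (simp_all add: q_def)
  then obtain t1 where "t1 < T" and t1: "\<And>t. t1 < t \<Longrightarrow> t < T \<Longrightarrow> ereal ((T - t) powr q) *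
      Linf_norm (ball 0 r) (\<lambda>x. norm x powr (\<sigma> * q) * u x t) < ereal \<epsilon>"
    unfolding eventually_at_left_field by blast
  define t0 where "t0 = (max t1 0 + T) / 2"
  have t0: "t1 < t0" "0 < t0" "t0 < T"
    using \<open>t1 < T\<close> \<open>T > 0\<close> by (auto simp: t0_def)

  have weighted: "norm x powr (\<sigma> * q) * u x t \<le> \<epsilon> * (T - t) powr (-q)"
    if "x \<in> ball 0 r" "t0 \<le> t" "t < T" for x t
  proof -
    have lt: "ereal ((T - t) powr q) *
        Linf_norm (ball 0 r) (\<lambda>x. norm x powr (\<sigma> * q) * u x t) < ereal \<epsilon>"
      using t1[of t] that t0 by simp
    have "continuous_on (ball 0 r) (\<lambda>x. u x t)"
      by (rule continuous_on_compose2[OF cont, of _ "\<lambda>x. (x, t)", simplified])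
        (use that t0 \<open>r < R\<close> in \<open>auto intro!: continuous_intros\<close>)
    then have c: "continuous_on (ball 0 r) (\<lambda>x. norm x powr (\<sigma> * q) * u x t)"
      using \<open>\<sigma> > 0\<close> \<open>q > 0\<close> by (intro continuous_on_powr' continuous_intros) auto
    have "Linf_norm (ball 0 r) (\<lambda>x. norm x powr (\<sigma> * q) * u x t) \<le> ereal (\<epsilon> * (T - t) powr (-q))"
      using lt \<open>t < T\<close>
      by (cases "Linf_norm (ball 0 r) (\<lambda>x. norm x powr (\<sigma> * q) * u x t)")
        (auto simp: powr_minus field_simps)
    from abs_le_of_Linf_norm_le[OF open_ball c this \<open>x \<in> ball 0 r\<close>] show ?thesis by simp
  qed

  have potential: "norm x powr \<sigma> * u x t powr (p - 1) \<le> (1/2 * q) / (T - t)"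
    if "x \<in> ball 0 r" "t0 \<le> t" "t < T" for x t
  proof -
    have "0 \<le> u x t" using nonneg[of x t] that t0 \<open>r < R\<close> by simp
    then have "(norm x powr (\<sigma> * q) * u x t) powr (p - 1) \<le> (\<epsilon> * (T - t) powr (-q)) powr (p - 1)"
      using weighted[OF that] \<open>p > 1\<close> by (intro powr_mono2) auto
    moreover have q1: "q * (p - 1) = 1" using \<open>p > 1\<close> by (simp add: q_def)
    have "(norm x powr (\<sigma> * q) * u x t) powr (p - 1) = norm x powr \<sigma> * u x t powr (p - 1)"
      using q1 by (simp add: powr_mult powr_powr mult.assoc)
    moreover have "(\<epsilon> * (T - t) powr (-q)) powr (p - 1) = (1/2 * q) powr 1 * (T - t) powr (-1)"
      using q1 by (simp add: powr_mult powr_powr \<epsilon>_def)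
    moreover have "(1/2 * q) powr 1 * (T - t) powr (-1) = (1/2 * q) / (T - t)"
      using \<open>q > 0\<close> \<open>t < T\<close> powr_neg_one[of "T - t"] by simp
    ultimately show ?thesis by simp
  qed
  have subsolution: "deriv (u x) t \<le> laplacian (\<lambda>y. u y t) x + V * u x t"
    if "x \<in> ball 0 r" "t0 \<le> t" "t < T" and V: "norm x powr \<sigma> * u x t powr (p - 1) \<le> V" for x t V
  proof -
    have u: "0 \<le> u x t" using nonneg[of x t] that t0 \<open>r < R\<close> by simp
    then have "norm x powr \<sigma> * u x t powr p = norm x powr \<sigma> * u x t powr (p - 1) * u x t"
      using powr_mult_base[of "u x t" "p - 1"] by (simp add: mult_ac)
    also have "\<dots> \<le> V * u x t"
      using V u by (rule mult_right_mono)
    finally show ?thesis using eqn[of x t] that t0 \<open>r < R\<close> by simp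
  qed

  \<comment> \<open>On \<open>r/2 \<le> norm x\<close> the weight is bounded below, so the hypothesis gives a type I bound there,
    with no information needed at the origin.\<close>
  obtain C1 where "C1 \<ge> 0" and C1: "\<And>x t. x \<in> ball 0 (r/2) \<Longrightarrow> t0 \<le> t \<Longrightarrow> t < T \<Longrightarrow>
      u x t \<le> C1 * (T - t) powr (-(1/2 * q))"
  proof (rule subsolution_interior_bound[where \<rho> = r and ?t0.0 = t0 and T = T and \<delta> = "1/2 * q" and a = q and A = 0
        and M = "\<epsilon> * (r/2) powr (- (\<sigma> * q))" and u = u and \<Omega> = "ball 0 R"])
    show "continuous_on (cball 0 r \<times> {t0..<T}) (\<lambda>(x, t). u x t)"
      by (rule continuous_on_subset[OF cont]) (use t0 \<open>r < R\<close> in auto)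
    fix x :: "real^'n" and t assume x: "x \<in> ball 0 r" and t: "t0 < t" "t < T"
    have "0 \<le> u x t" using nonneg[of x t] x t t0 \<open>r < R\<close> by simp
    then show "deriv (u x) t \<le> laplacian (\<lambda>y. u y t) x
        + ((1/2 * q) / (T - t) + 0 * (T - t) powr (-1/2)) * u x t"
      using subsolution[of x t, OF _ _ _ potential[of x t]] x t by simp
    assume "r / 2 \<le> norm x"
    then have "(r/2) powr (\<sigma> * q) * u x t \<le> norm x powr (\<sigma> * q) * u x t"
      using \<open>0 < r\<close> \<open>\<sigma> > 0\<close> \<open>q > 0\<close> \<open>0 \<le> u x t\<close> by (intro mult_right_mono powr_mono2) auto
    also have "\<dots> \<le> \<epsilon> * (T - t) powr (-q)" using weighted x t by simp
    finally show "u x t \<le> \<epsilon> * (r/2) powr (- (\<sigma> * q)) * (T - t) powr (-q)"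
      using \<open>0 < r\<close> by (simp add: powr_minus[of _ "\<sigma> * q"] field_simps)
  qed (use reg t0 assms \<open>q > 0\<close> \<open>\<epsilon> > 0\<close> in auto)

  \<comment> \<open>The improved rate makes the potential integrable in time, so the critical part is absent.\<close>
  obtain C2 where C2: "\<And>x t. x \<in> ball 0 (r/4) \<Longrightarrow> t0 \<le> t \<Longrightarrow> t < T \<Longrightarrow> u x t \<le> C2"
  proof (rule subsolution_interior_bound[where \<rho> = "r/2" and ?t0.0 = t0 and T = T and \<delta> = 0 and a = "1/2 * q"
        and A = "R powr \<sigma> * C1 powr (p - 1)" and M = C1 and u = u and \<Omega> = "ball 0 R"])
    show "continuous_on (cball 0 (r/2) \<times> {t0..<T}) (\<lambda>(x, t). u x t)"
      by (rule continuous_on_subset[OF cont]) (use t0 \<open>r < R\<close> \<open>0 < r\<close> in auto)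
    fix x :: "real^'n" and t assume x: "x \<in> ball 0 (r/2)" and t: "t0 < t" "t < T"
    show "u x t \<le> C1 * (T - t) powr (-(1/2 * q))" using C1 x t by simp
    have "0 \<le> u x t" using nonneg[of x t] x t t0 \<open>r < R\<close> \<open>0 < r\<close> by simp
    have "norm x powr \<sigma> * u x t powr (p - 1) \<le> R powr \<sigma> * (C1 * (T - t) powr (-(1/2 * q))) powr (p - 1)"
      using C1[of x t] x t \<open>0 \<le> u x t\<close> \<open>p > 1\<close> \<open>\<sigma> > 0\<close> \<open>r < R\<close> \<open>0 < r\<close>
      by (intro mult_mono powr_mono2) auto
    also have "\<dots> = R powr \<sigma> * C1 powr (p - 1) * (T - t) powr (-1/2)"
    proof -
      have "-(1/2 * q) * (p - 1) = -1/2"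
        using \<open>p > 1\<close> by (simp add: q_def field_simps)
      then show ?thesis by (simp only: powr_mult powr_powr mult.assoc)
    qed
    finally show "deriv (u x) t \<le> laplacian (\<lambda>y. u y t) x
        + (0 / (T - t) + R powr \<sigma> * C1 powr (p - 1) * (T - t) powr (-1/2)) * u x t"
      using subsolution[of x t] x t \<open>0 < r\<close> by simp
  next
    fix C assume "\<And>x t. x \<in> ball 0 (r/2/2) \<Longrightarrow> t0 \<le> t \<Longrightarrow> t < T \<Longrightarrow> u x t \<le> C * (T - t) powr (-0)"
    then show thesis by (intro that[of C]) auto
  qed (use reg t0 assms \<open>q > 0\<close> \<open>C1 \<ge> 0\<close> in auto)

  obtain xs ts where xs: "xs \<longlonglongrightarrow> 0" and ts: "ts \<longlonglongrightarrow> T" and in_Q: "\<And>j. ts j \<in> {0<..<T}" "\<And>j. xs j \<in> ball 0 R"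
    and unbdd: "filterlim (\<lambda>j. \<bar>u (xs j) (ts j)\<bar>) at_top sequentially"
    using blowup by (auto simp: blow_up_point_def)
  have "\<forall>\<^sub>F j in sequentially. xs j \<in> ball 0 (r/4)"
    using topological_tendstoD[OF xs open_ball, of 0 "r/4"] \<open>0 < r\<close> by simp
  moreover have "\<forall>\<^sub>F j in sequentially. t0 < ts j"
    using order_tendstoD(1)[OF ts \<open>t0 < T\<close>] .
  moreover have "\<forall>\<^sub>F j in sequentially. C2 < \<bar>u (xs j) (ts j)\<bar>"
    using unbdd by (simp add: filterlim_at_top_dense)
  ultimately have "\<forall>\<^sub>F j in sequentially. False"
  proof eventually_elim
    case (elim j)
    then have "u (xs j) (ts j) \<le> C2" using C2 in_Q(1)[of j] by simp
    moreover have "0 \<le> u (xs j) (ts j)"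
      using nonneg[of "xs j" "ts j"] in_Q[of j] by simp
    ultimately show False using elim by simp
  qed
  then show False by simp
qed

end
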